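(* Let $\alpha \in (0,1)$ be fixed. For each $n$, let $A \subseteq \{1,\dots,n\}$ be a random set in which each $m \in \{1,\dots,n\}$ belongs to $A$ independently with probability $\alpha$. Let $A/A = \{a/a' : a, a' \in A\}$ (a set of positive rationals). Then, as $n \to \infty$, with probability $1-o(1)$ we have $|A/A| \sim \mu_2(\alpha) n^2$; that is, for every $\varepsilon > 0$, $$\lim_{n\to\infty} \mathbb{P}\left( \left| \frac{|A/A|}{\mu_2(\alpha) n^2} - 1 \right| > \varepsilon \right) = 0,$$ where $$\mu_2(\alpha) = \frac{\alpha^2}{\zeta(2)} \frac{\operatorname{Li}_2(1-\alpha^2)}{1-\alpha^2}, \qquad \operatorname{Li}_2(z) = \sum_{k \ge 1} \frac{z^k}{k^2}.$$
   Context: $\zeta$ is the Riemann zeta function, so $\zeta(2) = \pi^2/6$; $\operatorname{Li}_2$ is the dilogarithm. *)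

theory Defs
  imports "HOL-Probability.Probability"
begin

(* The Dirichlet series, which is the definition of the Riemann zeta function for s > 1;
   the analytic continuation is not covered. *)
definition riemann_zeta :: "real \<Rightarrow> real" where
  "riemann_zeta s = (\<Sum>k. 1 / real (Suc k) powr s)"

(* Meaningful for \<bar>z\<bar> \<le> 1, where the series converges. *)
definition Li2 :: "real \<Rightarrow> real" where
  "Li2 z = (\<Sum>k. z ^ Suc k / real (Suc k) ^ 2)"

definition mu2 :: "real \<Rightarrow> real" where
  "mu2 \<alpha> = \<alpha>\<^sup>2 / riemann_zeta 2 * (Li2 (1 - \<alpha>\<^sup>2) / (1 - \<alpha>\<^sup>2))"

definition ratio_set :: "nat set \<Rightarrow> rat set" where
  "ratio_set A = {of_nat a / of_nat a' | a a'. a \<in> A \<and> a' \<in> A}"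

(* The function f drawn from the product of independent Bernoulli distributions is the
   membership predicate; Pi_pmf makes it False outside {1..n}. *)
definition random_subset :: "nat \<Rightarrow> real \<Rightarrow> nat set pmf" where
  "random_subset n \<alpha> = map_pmf (\<lambda>f. {m. f m}) (Pi_pmf {1..n} False (\<lambda>_. bernoulli_pmf \<alpha>))"

end

(*
  A coprime pair (r, s) in {1..n}^2 gives an element of A/A iff one of the floor(n / max r s) pairs
  (k r, k s) lies in A^2. If max r s > sqrt n these pairs are disjoint, so with q = 1 - alpha^2 the
  probability is 1 - q^floor(n / max r s); the remaining pairs are at most n in number. Expanding
  1 - q^m as a geometric sum reduces the expectation of |A/A| to counting coprime pairs in
  {1..floor(n/j)}^2, whose number is asymptotic to (n/j)^2 / zeta(2), and summing over j produces
  the dilogarithm. Adding or removing a single element of A changes |A/A| by at most 2n, so the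
  variance is O(n^3) and Chebyshev's inequality gives concentration.
*)
theory Submission
  imports Defs
begin

section \<open>Product distributions: conditioning, variance, disjoint pairs\<close>

lemma finite_set_Pi_pmf:
  assumes "finite S" "\<And>x. x \<in> S \<Longrightarrow> finite (set_pmf (p x))"
  shows "finite (set_pmf (Pi_pmf S d p))"
  using assms by (simp add: set_Pi_pmf finite_PiE_dflt)

text \<open>Fubini for a single coordinate. Finite supports turn all expectations into finite sums,
  so integrability is never an issue. Both inductions over coordinates below peel off coordinates
  with it.\<close>

lemma expectation_Pi_pmf_insert:
  fixes g :: "('a \<Rightarrow> 'b) \<Rightarrow> real"
  assumes "finite S" "x \<notin> S" "\<And>y. y \<in> insert x S \<Longrightarrow> finite (set_pmf (p y))"
  shows "measure_pmf.expectation (Pi_pmf (insert x S) d p) g =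
    measure_pmf.expectation (p x) (\<lambda>y. measure_pmf.expectation (Pi_pmf S d p) (\<lambda>f. g (f(x := y))))"
proof -
  have "finite (set_pmf (Pi_pmf S d p))" using assms by (intro finite_set_Pi_pmf) auto
  hence *: "finite (set_pmf (Pi_pmf S d p \<bind> (\<lambda>f. return_pmf (f(x := y)))))" for y
    by (simp add: set_bind_pmf)
  have "measure_pmf.expectation (Pi_pmf (insert x S) d p) g =
     measure_pmf.expectation (p x) (\<lambda>y. measure_pmf.expectation (map_pmf (\<lambda>f. f(x := y)) (Pi_pmf S d p)) g)"
    using assms * unfolding Pi_pmf_insert'[OF assms(1,2)] map_pmf_def
    by (subst pmf_expectation_bind[where A="set_pmf (p x)"]) (auto simp: integral_measure_pmf[where A = "set_pmf (p x)"])
  thus ?thesis by simp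
qed

text \<open>The case of constant coordinate oscillation of the Efron--Stein inequality.\<close>

lemma variance_Pi_pmf_le:
  fixes g :: "('a \<Rightarrow> 'b) \<Rightarrow> real"
  assumes "finite S" "\<And>x. x \<in> S \<Longrightarrow> finite (set_pmf (p x))"
    and "\<And>f x y z. x \<in> S \<Longrightarrow> \<bar>g (f(x := y)) - g (f(x := z))\<bar> \<le> c"
  shows "measure_pmf.variance (Pi_pmf S d p) g \<le> real (card S) * c\<^sup>2"
  using assms
proof (induction S arbitrary: g rule: finite_induct)
  case empty
  then show ?case by simp
next
  case (insert x S)
  let ?P = "Pi_pmf S d p" and ?Q = "Pi_pmf (insert x S) d p"
  have finP: "finite (set_pmf ?P)" and finQ: "finite (set_pmf ?Q)"
    using insert by (auto intro!: finite_set_Pi_pmf)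
  have fin: "finite (set_pmf (p x))" using insert by auto
  note [simp] = integrable_measure_pmf_finite[OF finP] integrable_measure_pmf_finite[OF finQ]
    integrable_measure_pmf_finite[OF fin]
  \<comment> \<open>The mean of \<open>g\<close> given that coordinate \<open>x\<close> equals
    \<open>y\<close>. By the law of total variance, the variance of \<open>g\<close> is the mean of
    the conditional variances, bounded by the induction hypothesis, plus the variance of
    \<open>h\<close>.\<close>
  define h where "h = (\<lambda>y. measure_pmf.expectation ?P (\<lambda>f. g (f(x := y))))"
  note ins = expectation_Pi_pmf_insert[OF insert.hyps(1,2) insert.prems(1)]
  have Eg: "measure_pmf.expectation ?Q g = measure_pmf.expectation (p x) h"
    unfolding h_def by (rule ins) auto
  have var: "measure_pmf.variance ?P (\<lambda>f. g (f(x := y))) \<le> real (card S) * c\<^sup>2" for y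
  proof (rule insert.IH)
    fix f x' y' z assume "x' \<in> S"
    with insert.hyps have "x \<noteq> x'" by auto
    thus "\<bar>g (f(x' := y', x := y)) - g (f(x' := z, x := y))\<bar> \<le> c"
      using insert.prems(2)[of x' "f(x := y)" y' z] \<open>x' \<in> S\<close>
      fun_upd_twist[OF \<open>x \<noteq> x'\<close>, of f] by (metis insertI2)
  qed (use insert in auto)
  have hc: "\<bar>h y - h z\<bar> \<le> c" for y z
  proof -
    have "h y - h z = measure_pmf.expectation ?P (\<lambda>f. g (f(x := y)) - g (f(x := z)))"
      by (simp add: h_def)
    also have "\<bar>\<dots>\<bar> \<le> measure_pmf.expectation ?P (\<lambda>f. \<bar>g (f(x := y)) - g (f(x := z))\<bar>)"
      by (rule integral_abs_bound)
    also have "\<dots> \<le> measure_pmf.expectation ?P (\<lambda>_. c)"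
      by (intro integral_mono insert.prems(2)) auto
    finally show ?thesis by simp
  qed
  \<comment> \<open>A function whose values differ pairwise by at most \<open>c\<close> stays within
    \<open>c\<close> of its own mean.\<close>
  have "measure_pmf.expectation (p x) (\<lambda>y. (h y - measure_pmf.expectation (p x) h)\<^sup>2) \<le>
      measure_pmf.expectation (p x) (\<lambda>_. c\<^sup>2)"
  proof (intro integral_mono)
    fix y
    have "\<bar>h y - measure_pmf.expectation (p x) h\<bar> = \<bar>measure_pmf.expectation (p x) (\<lambda>z. h y - h z)\<bar>"
      by simp
    also have "\<dots> \<le> measure_pmf.expectation (p x) (\<lambda>z. \<bar>h y - h z\<bar>)"
      by (rule integral_abs_bound)
    also have "\<dots> \<le> measure_pmf.expectation (p x) (\<lambda>_. c)"
      by (intro integral_mono) (use hc in auto)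
    finally have "\<bar>h y - measure_pmf.expectation (p x) h\<bar> \<le> \<bar>c\<bar>" by simp
    thus "(h y - measure_pmf.expectation (p x) h)\<^sup>2 \<le> c\<^sup>2" by (simp add: abs_le_square_iff)
  qed auto
  hence varh: "measure_pmf.variance (p x) h \<le> c\<^sup>2" by simp
  have "measure_pmf.variance ?Q g =
      measure_pmf.expectation ?Q (\<lambda>f. (g f)\<^sup>2) - (measure_pmf.expectation ?Q g)\<^sup>2"
    by (intro measure_pmf.variance_eq) auto
  also have "\<dots> = measure_pmf.expectation (p x) (\<lambda>y. measure_pmf.variance ?P (\<lambda>f. g (f(x := y))) + (h y)\<^sup>2)
      - (measure_pmf.expectation (p x) h)\<^sup>2"
    unfolding Eg h_def by (subst ins, simp, subst measure_pmf.variance_eq) auto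
  also have "\<dots> = measure_pmf.expectation (p x) (\<lambda>y. measure_pmf.variance ?P (\<lambda>f. g (f(x := y))))
      + measure_pmf.variance (p x) h"
    by (subst (2) measure_pmf.variance_eq) auto
  also have "measure_pmf.expectation (p x) (\<lambda>y. measure_pmf.variance ?P (\<lambda>f. g (f(x := y))))
      \<le> measure_pmf.expectation (p x) (\<lambda>y. real (card S) * c\<^sup>2)"
    by (intro integral_mono) (use var in auto)
  finally show ?case using varh insert.hyps by (simp add: algebra_simps)
qed

text \<open>The pairs occupy disjoint coordinates, so the events are independent, and each pair is
  incomplete with probability \<open>1 - \<alpha>\<^sup>2\<close>. The induction removes the two
  coordinates of one pair from \<open>S\<close>, hence \<open>S\<close> is generalised.\<close>

lemma prob_no_pair_Pi_bernoulli:
  fixes u v :: "'k \<Rightarrow> 'a"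
  assumes "finite K" "0 \<le> \<alpha>" "\<alpha> \<le> 1" "finite S" "u ` K \<union> v ` K \<subseteq> S"
    and "inj_on u K" "inj_on v K" "u ` K \<inter> v ` K = {}"
  shows "measure_pmf.prob (Pi_pmf S False (\<lambda>_. bernoulli_pmf \<alpha>)) {f. \<forall>k\<in>K. \<not> (f (u k) \<and> f (v k))}
    = (1 - \<alpha>\<^sup>2) ^ card K"
  using assms
proof (induction K arbitrary: S rule: finite_induct)
  case empty
  then show ?case by simp
next
  case (insert k K)
  let ?E = "\<lambda>K. {f. \<forall>k\<in>K. \<not> (f (u k) \<and> f (v k))}"
  let ?P = "\<lambda>S. Pi_pmf S False (\<lambda>_. bernoulli_pmf \<alpha>)"
  define T where "T = S - {u k, v k}"
  have S: "S = insert (u k) (insert (v k) T)" using insert.prems by (auto simp: T_def)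
  have fin: "finite T" "finite (insert (v k) T)" using insert.prems by (auto simp: T_def)
  have nin: "u k \<notin> insert (v k) T" "v k \<notin> T" using insert.prems by (auto simp: T_def)
  have uv: "u k \<noteq> v k" using nin by auto
  have ne: "u j \<noteq> u k" "u j \<noteq> v k" "v j \<noteq> u k" "v j \<noteq> v k" if "j \<in> K" for j
  proof -
    have "u j \<in> u ` K" "v j \<in> v ` K" "u k \<notin> u ` K" "v k \<notin> v ` K" "u ` K \<inter> {v k} = {}" "v ` K \<inter> {u k} = {}"
      using insert.prems insert.hyps that by auto
    thus "u j \<noteq> u k" "u j \<noteq> v k" "v j \<noteq> u k" "v j \<noteq> v k" by auto
  qed
  have IH: "measure_pmf.prob (?P T) (?E K) = (1 - \<alpha>\<^sup>2) ^ card K"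
    by (intro insert.IH) (use insert.prems fin ne in \<open>auto simp: T_def\<close>)
  have ind: "indicator (?E (insert k K)) (f(v k := b, u k := a)) = (if a \<and> b then 0 else indicator (?E K) f :: real)"
    for f a b
    using ne uv by (auto simp: indicator_def)
  have "measure_pmf.prob (?P S) (?E (insert k K)) =
      measure_pmf.expectation (?P S) (indicator (?E (insert k K)))"
    by simp
  also have "\<dots> = measure_pmf.expectation (bernoulli_pmf \<alpha>) (\<lambda>a. measure_pmf.expectation (bernoulli_pmf \<alpha>)
     (\<lambda>b. measure_pmf.expectation (?P T) (\<lambda>f. if a \<and> b then 0 else indicator (?E K) f)))"
    unfolding S
    by (subst expectation_Pi_pmf_insert, (use fin nin in auto)[3],
        subst expectation_Pi_pmf_insert, (use fin nin in auto)[3]) (simp only: ind)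
  also have "\<dots> = (1 - \<alpha>\<^sup>2) * measure_pmf.prob (?P T) (?E K)"
    using insert.prems by (simp add: power2_eq_square algebra_simps)
  finally show ?case using insert.hyps IH by simp
qed

section \<open>Coprime pairs, which encode fractions in lowest terms\<close>

definition coprime_pairs :: "nat \<Rightarrow> (nat \<times> nat) set" where
  "coprime_pairs n = {(r, s). 1 \<le> r \<and> r \<le> n \<and> 1 \<le> s \<and> s \<le> n \<and> coprime r s}"

lemma finite_coprime_pairs [simp]: "finite (coprime_pairs n)"
  by (rule finite_subset[of _ "{1..n} \<times> {1..n}"]) (auto simp: coprime_pairs_def)

lemma coprime_pairs_0 [simp]: "coprime_pairs 0 = {}"
  by (auto simp: coprime_pairs_def)

lemma card_coprime_pairs_le: "card (coprime_pairs n) \<le> n\<^sup>2"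
proof -
  have "card (coprime_pairs n) \<le> card ({1..n} \<times> {1..n})"
    by (intro card_mono) (auto simp: coprime_pairs_def)
  thus ?thesis by (simp add: power2_eq_square)
qed

text \<open>Dividing by the gcd sorts the pairs in the square: those with gcd \<open>d\<close> are
  \<open>d\<close> times the coprime pairs with entries up to \<open>n div d\<close>.\<close>

lemma sum_card_coprime_pairs_div: "(\<Sum>d=1..n. card (coprime_pairs (n div d))) = n\<^sup>2"
proof -
  let ?T = "SIGMA d:{1..n}. coprime_pairs (n div d)"
  have "bij_betw (\<lambda>(d, r, s). (d * r, d * s)) ?T ({1..n} \<times> {1..n})"
  proof (rule bij_betwI[where g = "\<lambda>(a, b). (gcd a b, a div gcd a b, b div gcd a b)"])
    show "(\<lambda>(d, r, s). (d * r, d * s)) \<in> ?T \<rightarrow> {1..n} \<times> {1..n}"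
      by (auto simp: coprime_pairs_def less_eq_div_iff_mult_less_eq mult.commute)
    show "(\<lambda>(a, b). (gcd a b, a div gcd a b, b div gcd a b)) \<in> {1..n} \<times> {1..n} \<rightarrow> ?T"
    proof (rule Pi_I)
      fix x assume "x \<in> {1..n} \<times> {1..n}"
      then obtain a b where x: "x = (a, b)" and ab: "a \<in> {1..n}" "b \<in> {1..n}" by auto
      hence "gcd a b \<le> a" by (intro gcd_le1_nat) auto
      hence "gcd a b \<le> n"
        using ab by (meson atLeastAtMost_iff le_trans)
      moreover have "gcd a b \<ge> 1" using ab by (auto simp: Suc_le_eq)
      moreover have "coprime (a div gcd a b) (b div gcd a b)"
        using ab by (intro div_gcd_coprime) auto
      moreover have "a div gcd a b > 0" "b div gcd a b > 0"
        using ab by (auto simp: div_greater_zero_iff gcd_le1_nat gcd_le2_nat)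
      moreover have "a div gcd a b \<le> n div gcd a b" "b div gcd a b \<le> n div gcd a b"
        using ab by (auto intro: div_le_mono)
      ultimately show "(\<lambda>(a, b). (gcd a b, a div gcd a b, b div gcd a b)) x \<in> ?T"
        using x ab by (auto simp: coprime_pairs_def)
    qed
  qed (auto simp: coprime_pairs_def gcd_mult_distrib_nat[symmetric])
  hence "card ?T = card ({1..n} \<times> {1..n})" by (rule bij_betw_same_card)
  thus ?thesis by (simp add: power2_eq_square)
qed

section \<open>Analytic tools: zeta(2), dominated convergence, upper limits\<close>

lemma tendsto_div_nat_over_nat: "(\<lambda>n. real (n div d) / real n) \<longlonglongrightarrow> 1 / real d"
proof (cases "d = 0")
  case False
  have "(\<lambda>n. real_of_int \<lfloor>(1 / real d) * real n\<rfloor> / real n) \<longlonglongrightarrow> 1 / real d"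
    by real_asymp
  thus ?thesis
    by (simp add: floor_divide_of_nat_eq)
qed simp

lemma riemann_zeta_2_sums: "(\<lambda>k. 1 / (real (Suc k))\<^sup>2) sums riemann_zeta 2"
  and riemann_zeta_2: "riemann_zeta 2 = pi\<^sup>2 / 6"
proof -
  have *: "1 / real (Suc k) powr 2 = 1 / (real (Suc k))\<^sup>2" for k
    by (subst powr_numeral) auto
  have **: "(\<lambda>k. 1 / (real (Suc k))\<^sup>2) sums (pi\<^sup>2 / 6)"
    using inverse_squares_sums by (simp add: add.commute)
  thus "(\<lambda>k. 1 / (real (Suc k))\<^sup>2) sums riemann_zeta 2" "riemann_zeta 2 = pi\<^sup>2 / 6"
    unfolding riemann_zeta_def * by (auto simp: sums_iff)
qed

text \<open>The upper bound makes \<open>riemann_zeta 2 - 1\<close> a contraction factor in the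
  density theorem; bounding pi by 3.2 is accurate enough.\<close>

lemma riemann_zeta_2_bounds: "1 < riemann_zeta 2" "riemann_zeta 2 < 2"
proof -
  have "pi > 3" "pi < 32/10" using pi_approx by (auto simp: abs_if split: if_splits)
  hence "3 * 3 < pi * pi" "pi * pi < (32/10) * (32/10)"
    by (intro mult_strict_mono; simp)+
  thus "1 < riemann_zeta 2" "riemann_zeta 2 < 2"
    by (auto simp: riemann_zeta_2 power2_eq_square)
qed

text \<open>Dominated convergence for series, with \<open>M\<close> as the dominating
  sequence.\<close>

lemma tannery_seq:
  fixes a :: "nat \<Rightarrow> nat \<Rightarrow> real"
  assumes "\<And>k. (\<lambda>n. a k n) \<longlonglongrightarrow> b k" "\<And>k n. \<bar>a k n\<bar> \<le> M k" "summable M"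
  shows "(\<lambda>n. \<Sum>k. a k n) \<longlonglongrightarrow> (\<Sum>k. b k)"
  using tannerys_theorem[of a b sequentially M] assms
  by (auto simp: case_prod_unfold)

text \<open>Turns a sum whose range grows with \<open>n\<close> into a full series, the form that
  \<open>tannery_seq\<close> takes.\<close>

lemma suminf_Suc_eq_sum:
  fixes f :: "nat \<Rightarrow> real"
  assumes "\<And>k. k > n \<Longrightarrow> f k = 0"
  shows "(\<Sum>k. f (Suc k)) = (\<Sum>k=1..n. f k)"
proof -
  have "(\<Sum>k. f (Suc k)) = (\<Sum>k<n. f (Suc k))"
    using assms by (intro suminf_finite) auto
  also have "\<dots> = (\<Sum>k=1..n. f k)"
    by (intro sum.reindex_bij_witness[of _ "\<lambda>k. k - 1" Suc]) auto
  finally show ?thesis .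
qed

text \<open>Here \<open>s n\<close> is the supremum of the tail from \<open>n\<close> on and
  \<delta> is the upper limit of \<open>e\<close>. Unlike \<open>e\<close>, the majorant
  \<open>s\<close> is known to converge, so limits can be taken of expressions built from it. The
  last clause transfers an eventual upper bound on \<open>e\<close> to \<delta>.\<close>

lemma decreasing_envelope:
  fixes e :: "nat \<Rightarrow> real"
  assumes "\<And>n. 0 \<le> e n" "\<And>n. e n \<le> B"
  obtains s \<delta> where "s \<longlonglongrightarrow> \<delta>" "0 \<le> \<delta>" "\<And>n. e n \<le> s n" "\<And>n. 0 \<le> s n" "\<And>n. s n \<le> B"
    "\<And>b L. b \<longlonglongrightarrow> L \<Longrightarrow> eventually (\<lambda>n. e n \<le> b n) sequentially \<Longrightarrow> \<delta> \<le> L"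
proof -
  define s where "s = (\<lambda>n. SUP m\<in>{n..}. e m)"
  have bdd: "bdd_above (e ` {n..})" for n
    using assms(2) by (intro bdd_aboveI[of _ B]) auto
  have es: "e m \<le> s n" if "n \<le> m" for m n
    unfolding s_def using that by (intro cSUP_upper bdd) auto
  have s0: "0 \<le> s n" for n
    using assms(1)[of n] es[of n n] by linarith
  have sB: "s n \<le> C" if "\<And>m. m \<ge> n \<Longrightarrow> e m \<le> C" for n C
    unfolding s_def using that by (intro cSUP_least) auto
  have "decseq s"
    by (intro decseq_SucI sB es) auto
  then obtain \<delta> where \<delta>: "s \<longlonglongrightarrow> \<delta>" "\<And>n. \<delta> \<le> s n"
    using decseq_convergent[of s 0] s0 by blast
  show ?thesis
  proof (rule that[OF \<delta>(1)])
    show "0 \<le> \<delta>" by (rule LIMSEQ_le_const[OF \<delta>(1)]) (use s0 in auto)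
    fix b L assume b: "b \<longlonglongrightarrow> L" "eventually (\<lambda>n. e n \<le> b n) sequentially"
    show "\<delta> \<le> L"
    proof (rule field_le_epsilon)
      fix \<eta> :: real assume "\<eta> > 0"
      hence "eventually (\<lambda>n. b n < L + \<eta>) sequentially"
        by (intro order_tendstoD[OF b(1)]) auto
      hence "eventually (\<lambda>n. e n \<le> L + \<eta>) sequentially"
        using b(2) by eventually_elim auto
      then obtain N where "\<And>m. m \<ge> N \<Longrightarrow> e m \<le> L + \<eta>"
        by (auto simp: eventually_at_top_linorder)
      hence "s N \<le> L + \<eta>" by (rule sB)
      thus "\<delta> \<le> L + \<eta>" using \<delta>(2)[of N] by linarith
    qed
  qed (use es s0 sB assms(2) in auto)
qed

section \<open>The density of coprime pairs\<close>

text \<open>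
  Writing \<open>c n = C n / n\<^sup>2\<close> for the number \<open>C n\<close> of coprime pairs, sorting all pairs by their gcd gives
  \<open>\<Sum>d. C (n div d) = n\<^sup>2\<close>. Isolating the term \<open>d = 1\<close> bounds \<open>\<delta> = limsup \<bar>c n - 1 / \<zeta>(2)\<bar>\<close> by
  \<open>(\<zeta>(2) - 1) \<delta>\<close>, and \<open>\<zeta>(2) < 2\<close> forces \<open>\<delta> = 0\<close>; no Moebius inversion is needed.
\<close>

theorem coprime_pairs_density:
  "(\<lambda>n. real (card (coprime_pairs n)) / (real n)\<^sup>2) \<longlonglongrightarrow> 1 / riemann_zeta 2"
proof -
  define z where "z = riemann_zeta 2"
  have z: "1 < z" "z < 2" "(\<lambda>k. 1 / (real (Suc k))\<^sup>2) sums z"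
    using riemann_zeta_2_bounds riemann_zeta_2_sums by (auto simp: z_def)
  define c where "c = (\<lambda>n. real (card (coprime_pairs n)) / (real n)\<^sup>2)"
  define e where "e = (\<lambda>n. \<bar>c n - 1 / z\<bar>)"
  \<comment> \<open>The weights with which sorting by gcd reads
    \<open>(\<Sum>d=1..n. w d n * c (n div d)) = 1\<close>. Each is at most
    \<open>1 / (real d)\<^sup>2\<close> and tends to it, which supplies the dominating
    series.\<close>
  define w where "w = (\<lambda>d n. (real (n div d) / real n)\<^sup>2)"
  have c: "0 \<le> c n" "c n \<le> 1" for n
    using card_coprime_pairs_le[of n]
    by (auto simp: c_def divide_simps simp flip: of_nat_power)
  have "0 \<le> 1 / z" "1 / z \<le> 1" using z by auto
  hence e: "0 \<le> e n" "e n \<le> 1" for n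
    using c[of n] unfolding e_def by linarith+
  have w: "0 \<le> w d n" "w d n \<le> 1 / (real d)\<^sup>2" for d n
  proof -
    have "real (n div d) / real n \<le> 1 / real d"
      using of_nat_div_le_of_nat[of n d] by (cases "n = 0") (auto simp: field_simps)
    hence "w d n \<le> (1 / real d)\<^sup>2" unfolding w_def by (intro power_mono) auto
    thus "w d n \<le> 1 / (real d)\<^sup>2" by (simp add: power_divide)
  qed (simp add: w_def)
  have w_lim: "w d \<longlonglongrightarrow> 1 / (real d)\<^sup>2" for d
    using tendsto_power[OF tendsto_div_nat_over_nat[of d], of 2] by (simp add: w_def power_divide)
  have w0: "w d n = 0" if "d > n" for d n using that by (simp add: w_def)
  have w1: "w 1 n = 1" if "n > 0" for n using that by (simp add: w_def)
  \<comment> \<open>If \<open>d\<close> exceeds \<open>n\<close>, both sides are 0, as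
    \<open>coprime_pairs 0\<close> is empty.\<close>
  have wc: "w d n * c (n div d) = real (card (coprime_pairs (n div d))) / (real n)\<^sup>2" if "d > 0" for d n
    by (cases "n div d = 0") (auto simp: w_def c_def power_divide)
  have sum1: "(\<Sum>d=1..n. w d n * c (n div d)) = 1" if "n > 0" for n
  proof -
    have "(\<Sum>d=1..n. w d n * c (n div d)) = (\<Sum>d=1..n. real (card (coprime_pairs (n div d))) / (real n)\<^sup>2)"
      by (intro sum.cong wc) auto
    also have "\<dots> = real (\<Sum>d=1..n. card (coprime_pairs (n div d))) / (real n)\<^sup>2"
      by (simp add: sum_divide_distrib)
    finally show ?thesis using that unfolding sum_card_coprime_pairs_div by simp
  qed
  have summ: "summable (\<lambda>k. 1 / (real (Suc k))\<^sup>2)" and sumz: "(\<Sum>k. 1 / (real (Suc k))\<^sup>2) = z"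
    using z(3) by (auto simp: sums_iff)
  have summ2: "summable (\<lambda>k. 1 / (real (Suc (Suc k)))\<^sup>2)"
    using summ by (subst summable_Suc_iff)
  have sumz2: "(\<Sum>k. 1 / (real (Suc (Suc k)))\<^sup>2) = z - 1"
    using suminf_split_head[OF summ] sumz by simp
  define r where "r = (\<lambda>n. \<Sum>d=1..n. w d n)"
  have "(\<lambda>n. \<Sum>k. w (Suc k) n) \<longlonglongrightarrow> (\<Sum>k. 1 / (real (Suc k))\<^sup>2)"
    by (rule tannery_seq[OF w_lim _ summ]) (simp only: abs_of_nonneg w)
  moreover have "(\<Sum>k. w (Suc k) n) = r n" for n
    unfolding r_def by (rule suminf_Suc_eq_sum) (rule w0)
  ultimately have r: "r \<longlonglongrightarrow> z" by (simp only: sumz)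
  obtain s \<delta> where s: "s \<longlonglongrightarrow> \<delta>" "0 \<le> \<delta>" "\<And>n. e n \<le> s n" "\<And>n. 0 \<le> s n" "\<And>n. s n \<le> 1"
    and least: "\<And>b L. b \<longlonglongrightarrow> L \<Longrightarrow> eventually (\<lambda>n. e n \<le> b n) sequentially \<Longrightarrow> \<delta> \<le> L"
    by (rule decreasing_envelope[of e 1, OF e]) (rule that)
  \<comment> \<open>The series starts at \<open>d = 2\<close>, as the term for \<open>d = 1\<close>
    contains \<open>c n\<close> itself. Replacing \<open>e\<close> by \<open>s\<close> in the
    remaining terms gives them limits.\<close>
  define b where "b = (\<lambda>n. \<bar>1 - r n / z\<bar> + (\<Sum>k. w (Suc (Suc k)) n * s (n div Suc (Suc k))))"
  have "filterlim (\<lambda>n. n div Suc (Suc k)) at_top sequentially" for k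
    by (rule filterlim_at_top_div_const_nat) auto
  hence "(\<lambda>n. w (Suc (Suc k)) n * s (n div Suc (Suc k))) \<longlonglongrightarrow> 1 / (real (Suc (Suc k)))\<^sup>2 * \<delta>" for k
    by (intro tendsto_mult w_lim filterlim_compose[OF s(1)])
  moreover have ws: "\<bar>w (Suc (Suc k)) n * s (n div Suc (Suc k))\<bar> \<le> 1 / (real (Suc (Suc k)))\<^sup>2" for k n
    using mult_mono[OF w(2)[of "Suc (Suc k)" n] s(5)[of "n div Suc (Suc k)"]] s(4) w(1)
    by (simp add: abs_mult)
  ultimately have "(\<lambda>n. \<Sum>k. w (Suc (Suc k)) n * s (n div Suc (Suc k))) \<longlonglongrightarrow>
      (\<Sum>k. 1 / (real (Suc (Suc k)))\<^sup>2 * \<delta>)"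
    by (rule tannery_seq[OF _ _ summ2])
  also have "(\<Sum>k. 1 / (real (Suc (Suc k)))\<^sup>2 * \<delta>) = (z - 1) * \<delta>"
    using suminf_mult2[OF summ2, of \<delta>] sumz2 by simp
  finally have "b \<longlonglongrightarrow> \<bar>1 - z / z\<bar> + (z - 1) * \<delta>"
    unfolding b_def using z by (intro tendsto_intros r) auto
  hence b: "b \<longlonglongrightarrow> (z - 1) * \<delta>" using z by simp
  have "e n \<le> b n" if "n > 0" for n
  proof -
    have "{1..n} = insert 1 {2..n}" using that by auto
    hence split: "(\<Sum>d=1..n. f d) = f 1 + (\<Sum>d=2..n. f d)" for f :: "nat \<Rightarrow> real" by simp
    \<comment> \<open>Subtracting \<open>r n / z\<close> from \<open>sum1\<close> centres every
      \<open>c (n div d)\<close> at \<open>1 / z\<close>; the term for \<open>d = 1\<close> has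
      weight 1 and is the quantity to be bounded.\<close>
    have "1 - r n / z = (\<Sum>d=1..n. w d n * (c (n div d) - 1 / z))"
      using sum1[OF that] by (simp add: r_def algebra_simps sum_subtractf sum_divide_distrib)
    also have "\<dots> = (c n - 1 / z) + (\<Sum>d=2..n. w d n * (c (n div d) - 1 / z))"
      unfolding split using w1[OF that] by simp
    finally have "e n \<le> \<bar>1 - r n / z\<bar> + \<bar>\<Sum>d=2..n. w d n * (c (n div d) - 1 / z)\<bar>"
      by (simp add: e_def)
    also have "\<bar>\<Sum>d=2..n. w d n * (c (n div d) - 1 / z)\<bar> \<le> (\<Sum>d=2..n. \<bar>w d n * (c (n div d) - 1 / z)\<bar>)"
      by (rule sum_abs)
    also have "\<dots> \<le> (\<Sum>d=2..n. w d n * s (n div d))"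
      using s(3) w(1) by (intro sum_mono) (auto simp: abs_mult e_def intro!: mult_left_mono)
    also have "\<dots> = (\<Sum>k<n - 1. w (Suc (Suc k)) n * s (n div Suc (Suc k)))"
      by (intro sum.reindex_bij_witness[of _ "\<lambda>k. Suc (Suc k)" "\<lambda>d. d - 2"]) (auto simp: Suc_diff_Suc numeral_2_eq_2)
    also have "\<dots> \<le> (\<Sum>k. w (Suc (Suc k)) n * s (n div Suc (Suc k)))"
      using ws by (intro sum_le_suminf summable_comparison_test'[OF summ2]) (auto simp: w s)
    finally show ?thesis by (simp add: b_def)
  qed
  hence "eventually (\<lambda>n. e n \<le> b n) sequentially"
    by (intro eventually_mono[OF eventually_gt_at_top[of 0]])
  from least[OF b this] have "0 \<le> (z - 2) * \<delta>" by (simp add: algebra_simps)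
  hence "\<delta> = 0" using z s(2) by (auto simp: zero_le_mult_iff)
  hence "s \<longlonglongrightarrow> 0" using s(1) by simp
  hence "e \<longlonglongrightarrow> 0"
    using e s by (intro tendsto_sandwich[where f = "\<lambda>_. 0" and g = e and h = s]) auto
  hence "c \<longlonglongrightarrow> 1 / z"
    unfolding e_def by (simp add: tendsto_rabs_zero_iff LIM_zero_iff)
  thus ?thesis by (simp add: c_def z_def)
qed

section \<open>Combinatorics of ratio sets\<close>

text \<open>Each ratio has a unique form \<open>r / s\<close> in lowest terms, and the pairs with
  that ratio are the multiples \<open>(k * r, k * s)\<close>. Both entries are at most
  \<open>n\<close> exactly when \<open>k \<le> n div max r s\<close>. The witness \<open>k\<close>
  for a given pair is its gcd.\<close>

lemma card_ratio_set:
  assumes "A \<subseteq> {1..n}"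
  shows "card (ratio_set A) =
    card {(r, s) \<in> coprime_pairs n. \<exists>k\<in>{1..n div max r s}. k * r \<in> A \<and> k * s \<in> A}"
    (is "_ = card ?T")
proof -
  let ?q = "\<lambda>(r, s). of_nat r / of_nat s :: rat"
  have "inj_on ?q (coprime_pairs n)"
  proof (rule inj_onI, clarify)
    fix r s r' s' assume *: "(r, s) \<in> coprime_pairs n" "(r', s') \<in> coprime_pairs n"
      and "(of_nat r / of_nat s :: rat) = of_nat r' / of_nat s'"
    hence "(of_nat (r * s') :: rat) = of_nat (r' * s)"
      by (auto simp: coprime_pairs_def divide_simps split: if_splits)
    hence "r * s' = r' * s" by (simp only: of_nat_eq_iff)
    thus "r = r' \<and> s = s'"
      using * coprime_crossproduct_nat[of r s r' s'] by (auto simp: coprime_pairs_def coprime_commute)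
  qed
  hence inj: "inj_on ?q ?T" by (rule inj_on_subset) auto
  have "?q ` ?T = ratio_set A"
  proof (intro equalityI subsetI)
    fix x assume "x \<in> ?q ` ?T"
    then obtain r s k where *: "k \<ge> 1" "k * r \<in> A" "k * s \<in> A" "x = of_nat r / of_nat s"
      by auto
    hence "x = of_nat (k * r) / of_nat (k * s)" by simp
    thus "x \<in> ratio_set A" using * unfolding ratio_set_def by blast
  next
    fix x assume "x \<in> ratio_set A"
    then obtain a b where ab: "a \<in> A" "b \<in> A" "x = of_nat a / of_nat b"
      by (auto simp: ratio_set_def)
    hence pos: "a > 0" "b > 0" "a \<le> n" "b \<le> n" using assms by auto
    define g where "g = gcd a b"
    obtain r s where rs: "a = g * r" "b = g * s" "coprime r s"
      using gcd_coprime_exists[of a b] pos unfolding g_def by (metis gcd_pos_nat less_numeral_extra(3) mult.commute)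
    have g: "g > 0" "r > 0" "s > 0" using pos rs by auto
    have "g * r \<le> n" "g * s \<le> n" using pos rs by auto
    hence "g * max r s \<le> n" by (simp add: max_def)
    moreover have "r \<le> g * r" "s \<le> g * s" using g by auto
    hence "r \<le> n" "s \<le> n" using \<open>g * r \<le> n\<close> \<open>g * s \<le> n\<close> by linarith+
    ultimately have "(r, s) \<in> ?T"
      using ab rs g
      by (auto simp: coprime_pairs_def less_eq_div_iff_mult_less_eq intro!: bexI[of _ g])
    moreover have "x = ?q (r, s)" using ab rs g by simp
    ultimately show "x \<in> ?q ` ?T" by blast
  qed
  thus ?thesis using card_image[OF inj] by (simp only:)
qed

lemma finite_ratio_set: "finite A \<Longrightarrow> finite (ratio_set A)"
  by (rule finite_subset[of _ "(\<lambda>(a, b). of_nat a / of_nat b) ` (A \<times> A)"]) (auto simp: ratio_set_def)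

lemma card_ratio_set_mono: "A \<subseteq> B \<Longrightarrow> finite B \<Longrightarrow> card (ratio_set A) \<le> card (ratio_set B)"
  by (intro card_mono finite_ratio_set) (auto simp: ratio_set_def)

text \<open>Every new ratio has \<open>x\<close> as numerator or as denominator.\<close>

lemma card_ratio_set_insert_le:
  assumes "finite A"
  shows "card (ratio_set (insert x A)) \<le> card (ratio_set A) + 2 * card (insert x A)"
proof -
  let ?B = "insert x A"
  let ?U = "(\<lambda>a. of_nat x / of_nat a :: rat) ` ?B" and ?V = "(\<lambda>a. of_nat a / of_nat x :: rat) ` ?B"
  have "card (ratio_set ?B) \<le> card (ratio_set A \<union> (?U \<union> ?V))"
  proof (rule card_mono)
    show "ratio_set ?B \<subseteq> ratio_set A \<union> (?U \<union> ?V)" by (auto simp: ratio_set_def)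
  qed (use assms in \<open>simp add: finite_ratio_set\<close>)
  also have "\<dots> \<le> card (ratio_set A) + card (?U \<union> ?V)" by (rule card_Un_le)
  also have "card (?U \<union> ?V) \<le> card ?U + card ?V" by (rule card_Un_le)
  also have "\<dots> \<le> card ?B + card ?B" using assms by (intro add_mono card_image_le) auto
  finally show ?thesis by simp
qed

text \<open>Both sets lie between \<open>A\<close>, from which \<open>x\<close> is removed, and
  \<open>insert x A\<close>, so monotonicity squeezes the difference. Intersecting with
  \<open>{1..n}\<close> makes the bound hold for every predicate \<open>f\<close>, as
  \<open>variance_Pi_pmf_le\<close> demands.\<close>

lemma card_ratio_set_flip:
  assumes "x \<in> {1..n}"
  shows "\<bar>real (card (ratio_set ({m. (f(x := b)) m} \<inter> {1..n})))
    - real (card (ratio_set ({m. (f(x := b')) m} \<inter> {1..n})))\<bar> \<le> 2 * real n"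
proof -
  define A where "A = {m. f m} \<inter> {1..n} - {x}"
  have "card (insert x A) \<le> card {1..n}" using assms by (intro card_mono) (auto simp: A_def)
  hence up: "card (ratio_set (insert x A)) \<le> card (ratio_set A) + 2 * n"
    using card_ratio_set_insert_le[of A x] by (simp add: A_def)
  have sub: "A \<subseteq> {m. (f(x := c)) m} \<inter> {1..n}" "{m. (f(x := c)) m} \<inter> {1..n} \<subseteq> insert x A" for c
    by (auto simp: A_def)
  have "card (ratio_set A) \<le> card (ratio_set ({m. (f(x := c)) m} \<inter> {1..n}))"
       "card (ratio_set ({m. (f(x := c)) m} \<inter> {1..n})) \<le> card (ratio_set (insert x A))" for c
    by (intro card_ratio_set_mono sub; simp add: A_def)+
  from this[of b] this[of b'] up show ?thesis by linarith
qed

section \<open>The probability that a fraction occurs, and the sum over fractions\<close>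

text \<open>
  Since \<open>r\<close> and \<open>s\<close> are coprime, an overlap \<open>k * r = k' * s\<close> would force \<open>s \<le> k\<close> and \<open>r \<le> k'\<close>, so the witnessing pairs are
  disjoint, and the corresponding events independent, once \<open>max r s\<close> exceeds \<open>sqrt n\<close>.
\<close>

lemma prob_ratio_hit:
  assumes "0 \<le> \<alpha>" "\<alpha> \<le> 1" "(r, s) \<in> coprime_pairs n" "n < (max r s)\<^sup>2"
  shows "measure_pmf.prob (Pi_pmf {1..n} False (\<lambda>_. bernoulli_pmf \<alpha>))
      {f. \<exists>k\<in>{1..n div max r s}. f (k * r) \<and> f (k * s)} = 1 - (1 - \<alpha>\<^sup>2) ^ (n div max r s)"
proof -
  let ?P = "Pi_pmf {1..n} False (\<lambda>_. bernoulli_pmf \<alpha>)"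
  let ?K = "{1..n div max r s}"
  let ?E = "{f. \<forall>k\<in>?K. \<not> (f (k * r) \<and> f (k * s))}"
  have rs: "r > 0" "s > 0" "coprime r s" "r \<le> n" using assms by (auto simp: coprime_pairs_def)
  have K: "k * max r s \<le> n" if "k \<in> ?K" for k
    using that rs by (auto simp: less_eq_div_iff_mult_less_eq)
  have Kle: "k * r \<le> n" "k * s \<le> n" if "k \<in> ?K" for k
    using K[OF that] order_trans[OF mult_le_mono2] by (meson max.cobounded1 max.cobounded2)+
  have disj: "k * r \<noteq> k' * s" if "k \<in> ?K" "k' \<in> ?K" for k k'
  proof
    assume eq: "k * r = k' * s"
    have "s dvd k * r" "r dvd k' * s" unfolding eq by (simp, simp flip: eq)
    hence "s dvd k" "r dvd k'"
      using rs by (simp_all add: coprime_dvd_mult_left_iff coprime_commute)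
    hence "s \<le> k" "r \<le> k'" using that by (auto intro!: dvd_imp_le)
    \<comment> \<open>Since \<open>k\<close> and \<open>k'\<close> are at most
      \<open>n div max r s\<close>, both \<open>r\<close> and \<open>s\<close> are too. One of them
      equals \<open>max r s\<close>, so its square would be at most \<open>n\<close>.\<close>
    hence "s * max r s \<le> n" "r * max r s \<le> n"
      using K[OF that(1)] K[OF that(2)] by (meson le_trans mult_le_mono1)+
    hence "max r s * max r s \<le> n" by (auto simp: max_def split: if_splits)
    thus False using assms(4) by (simp add: power2_eq_square)
  qed
  have "measure_pmf.prob ?P ?E = (1 - \<alpha>\<^sup>2) ^ card ?K"
    by (rule prob_no_pair_Pi_bernoulli)
      (use assms rs Kle disj in \<open>auto simp: inj_on_def Suc_le_eq\<close>)
  moreover have "{f. \<exists>k\<in>?K. f (k * r) \<and> f (k * s)} = UNIV - ?E" by auto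
  ultimately show ?thesis
    using measure_pmf.prob_compl[of ?E ?P] by simp
qed

text \<open>These are the pairs out of reach of \<open>prob_ratio_hit\<close>. They lie in a square
  of side floor(sqrt n), which is negligible against the order n^2 of the main term.\<close>

lemma card_coprime_pairs_sqrt_le: "card {(r, s) \<in> coprime_pairs n. (max r s)\<^sup>2 \<le> n} \<le> n"
proof -
  define t where "t = nat \<lfloor>sqrt (real n)\<rfloor>"
  have t: "r \<le> t" if "r\<^sup>2 \<le> n" for r
  proof -
    have "real r \<le> sqrt (real n)" using that by (intro real_le_rsqrt) (simp flip: of_nat_power)
    thus ?thesis by (simp add: t_def le_nat_floor)
  qed
  have "r \<le> t \<and> s \<le> t" if "(max r s)\<^sup>2 \<le> n" for r s
    using t[OF that] by simp
  hence "card {(r, s) \<in> coprime_pairs n. (max r s)\<^sup>2 \<le> n} \<le> card ({1..t} \<times> {1..t})"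
    by (intro card_mono) (auto simp: coprime_pairs_def)
  also have "\<dots> = t\<^sup>2" by (simp add: power2_eq_square)
  also have "real t \<le> sqrt (real n)" by (simp add: t_def)
  hence "(real t)\<^sup>2 \<le> (sqrt (real n))\<^sup>2" by (intro power_mono) auto
  hence "t\<^sup>2 \<le> n" by (simp flip: of_nat_power)
  finally show ?thesis .
qed

text \<open>Expand \<open>1 - q ^ m\<close> as a geometric sum and exchange the summations:
  \<open>j \<le> n div max r s\<close> says precisely that both entries are at most
  \<open>n div j\<close>.\<close>

lemma sum_coprime_pairs_geometric:
  fixes q :: real
  shows "(\<Sum>(r, s)\<in>coprime_pairs n. 1 - q ^ (n div max r s)) =
    (\<Sum>j=1..n. (1 - q) * q ^ (j - 1) * real (card (coprime_pairs (n div j))))"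
proof -
  have geo: "1 - q ^ m = (\<Sum>j=1..m. (1 - q) * q ^ (j - 1))" for m
    by (induction m) (auto simp: algebra_simps)
  have sub: "coprime_pairs (n div j) \<subseteq> coprime_pairs n" for j
    using div_le_dividend[of n j] by (auto simp: coprime_pairs_def simp del: div_le_dividend intro: order_trans)
  have iff: "(r, s) \<in> coprime_pairs (n div j) \<longleftrightarrow> j \<le> n div max r s"
    if "(r, s) \<in> coprime_pairs n" "j \<ge> 1" for r s j
    using that by (auto simp: coprime_pairs_def less_eq_div_iff_mult_less_eq nat_mult_max_right mult.commute)
  have "(\<Sum>(r, s)\<in>coprime_pairs n. 1 - q ^ (n div max r s)) =
    (\<Sum>x\<in>coprime_pairs n. \<Sum>j=1..n. if x \<in> coprime_pairs (n div j) then (1 - q) * q ^ (j - 1) else 0)"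
  proof (intro sum.cong refl, clarify)
    fix r s assume rs: "(r, s) \<in> coprime_pairs n"
    have "{1..n div max r s} = {j\<in>{1..n}. j \<le> n div max r s}"
      using div_le_dividend[of n "max r s"] by (auto simp del: div_le_dividend)
    hence "(\<Sum>j=1..n div max r s. (1 - q) * q ^ (j - 1)) =
        (\<Sum>j=1..n. if j \<le> n div max r s then (1 - q) * q ^ (j - 1) else 0)"
      by (simp only: sum.inter_filter finite_atLeastAtMost)
    also have "\<dots> = (\<Sum>j=1..n. if (r, s) \<in> coprime_pairs (n div j) then (1 - q) * q ^ (j - 1) else 0)"
      using iff[OF rs] by (intro sum.cong) auto
    finally show "1 - q ^ (n div max r s) = \<dots>" by (simp add: geo)
  qed
  also have "\<dots> = (\<Sum>j=1..n. \<Sum>x\<in>coprime_pairs n. if x \<in> coprime_pairs (n div j) then (1 - q) * q ^ (j - 1) else 0)"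
    by (rule sum.swap)
  also have "\<dots> = (\<Sum>j=1..n. (1 - q) * q ^ (j - 1) * real (card (coprime_pairs (n div j))))"
  proof (intro sum.cong refl)
    fix j
    have "(\<Sum>x\<in>coprime_pairs n. if x \<in> coprime_pairs (n div j) then (1 - q) * q ^ (j - 1) else 0) =
      (\<Sum>x\<in>coprime_pairs n \<inter> coprime_pairs (n div j). (1 - q) * q ^ (j - 1))"
      by (simp only: sum.inter_restrict finite_coprime_pairs)
    also have "coprime_pairs n \<inter> coprime_pairs (n div j) = coprime_pairs (n div j)" using sub[of j] by blast
    finally show "(\<Sum>x\<in>coprime_pairs n. if x \<in> coprime_pairs (n div j) then (1 - q) * q ^ (j - 1) else 0) =
      (1 - q) * q ^ (j - 1) * real (card (coprime_pairs (n div j)))" by simp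
  qed
  finally show ?thesis .
qed

section \<open>The dilogarithm and the limit of the main term\<close>

text \<open>Dividing by \<open>x\<close> lowers the exponent by one, matching the factor
  \<open>q ^ (j - 1)\<close> of the geometric expansion.\<close>

lemma Li2_over_self:
  assumes "0 < x" "x < 1"
  shows "summable (\<lambda>k. x ^ k / (real (Suc k))\<^sup>2)" "Li2 x / x = (\<Sum>k. x ^ k / (real (Suc k))\<^sup>2)"
proof -
  show *: "summable (\<lambda>k. x ^ k / (real (Suc k))\<^sup>2)"
  proof (rule summable_comparison_test'[of "\<lambda>k. x ^ k" 0])
    fix k
    have "x ^ k / (real (Suc k))\<^sup>2 \<le> x ^ k / 1"
      using assms by (intro divide_left_mono one_le_power) auto
    thus "norm (x ^ k / (real (Suc k))\<^sup>2) \<le> x ^ k" using assms by (simp add: abs_mult)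
  qed (use assms in auto)
  have "Li2 x = x * (\<Sum>k. x ^ k / (real (Suc k))\<^sup>2)"
    unfolding Li2_def using suminf_mult[OF *, of x] by simp
  thus "Li2 x / x = (\<Sum>k. x ^ k / (real (Suc k))\<^sup>2)" using assms by simp
qed

lemma mu2_pos:
  assumes "0 < \<alpha>" "\<alpha> < 1"
  shows "mu2 \<alpha> > 0"
proof -
  have q: "0 < 1 - \<alpha>\<^sup>2" "1 - \<alpha>\<^sup>2 < 1" using assms by (auto simp: power_less_one_iff abs_square_less_1)
  have "(\<Sum>k. (1 - \<alpha>\<^sup>2) ^ k / (real (Suc k))\<^sup>2) > 0"
    using q by (intro suminf_pos Li2_over_self(1)) auto
  thus ?thesis
    using assms riemann_zeta_2_bounds unfolding mu2_def Li2_over_self(2)[OF q] by simp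
qed

text \<open>In the expanded sum the density theorem gives the limit of each term. The trivial bound
  n^2 on the count suffices for domination, because the weights \<open>(1 - q) * q ^ k\<close> are
  already summable. Finally \<open>1 - q\<close> is \<open>\<alpha>\<^sup>2\<close>.\<close>

lemma mean_main_term_tendsto:
  assumes "0 < \<alpha>" "\<alpha> < 1"
  defines "q \<equiv> 1 - \<alpha>\<^sup>2"
  shows "(\<lambda>n. (\<Sum>(r, s)\<in>coprime_pairs n. 1 - q ^ (n div max r s)) / (real n)\<^sup>2) \<longlonglongrightarrow> mu2 \<alpha>"
proof -
  have q: "0 < q" "q < 1" using assms by (auto simp: power_less_one_iff abs_square_less_1)
  define a where "a = (\<lambda>k n. (1 - q) * q ^ k * (real (card (coprime_pairs (n div Suc k))) / (real n)\<^sup>2))"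
  define z where "z = riemann_zeta 2"
  have "(\<lambda>n. real (card (coprime_pairs (n div Suc k))) / (real n)\<^sup>2) \<longlonglongrightarrow> 1 / z * (1 / real (Suc k))\<^sup>2" for k
  proof -
    have "filterlim (\<lambda>n. n div Suc k) at_top sequentially"
      by (rule filterlim_at_top_div_const_nat) auto
    hence "(\<lambda>n. real (card (coprime_pairs (n div Suc k))) / (real (n div Suc k))\<^sup>2 * (real (n div Suc k) / real n)\<^sup>2)
        \<longlonglongrightarrow> 1 / z * (1 / real (Suc k))\<^sup>2"
      unfolding z_def by (intro tendsto_mult tendsto_power tendsto_div_nat_over_nat
          filterlim_compose[OF coprime_pairs_density])
    \<comment> \<open>Cancelling \<open>m\<close> is also valid for \<open>m = 0\<close>, where both
      sides vanish.\<close>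
    moreover have "real (card (coprime_pairs m)) / (real m)\<^sup>2 * (real m / real n)\<^sup>2 =
        real (card (coprime_pairs m)) / (real n)\<^sup>2" for m n
      by (cases "m = 0") (auto simp: power_divide)
    ultimately show ?thesis by (simp only:)
  qed
  hence lim: "a k \<longlonglongrightarrow> (1 - q) * q ^ k * (1 / z * (1 / real (Suc k))\<^sup>2)" for k
    unfolding a_def by (intro tendsto_mult tendsto_const)
  have bound: "\<bar>a k n\<bar> \<le> (1 - q) * q ^ k" for k n
  proof -
    have "card (coprime_pairs (n div Suc k)) \<le> n\<^sup>2"
      by (rule order_trans[OF card_coprime_pairs_le]) (intro power_mono div_le_dividend, simp)
    hence "real (card (coprime_pairs (n div Suc k))) / (real n)\<^sup>2 \<le> 1"
      by (auto simp: divide_simps simp flip: of_nat_power)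
    hence "a k n \<le> (1 - q) * q ^ k * 1"
      unfolding a_def using q by (intro mult_left_mono) auto
    moreover have "0 \<le> a k n" unfolding a_def using q by auto
    ultimately show ?thesis by simp
  qed
  have "(\<lambda>n. \<Sum>k. a k n) \<longlonglongrightarrow> (\<Sum>k. (1 - q) * q ^ k * (1 / z * (1 / real (Suc k))\<^sup>2))"
    by (rule tannery_seq[OF lim bound]) (use q in \<open>auto intro!: summable_mult\<close>)
  also have "(\<Sum>k. (1 - q) * q ^ k * (1 / z * (1 / real (Suc k))\<^sup>2)) =
      (\<Sum>k. (1 - q) / z * (q ^ k / (real (Suc k))\<^sup>2))"
    by (simp add: power_divide)
  also have "\<dots> = (1 - q) / z * (Li2 q / q)"
    by (simp only: suminf_mult[OF Li2_over_self(1)[OF q]] Li2_over_self(2)[OF q])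
  also have "\<dots> = mu2 \<alpha>" by (simp add: mu2_def q_def z_def)
  also have "(\<lambda>n. \<Sum>k. a k n) = (\<lambda>n. (\<Sum>(r, s)\<in>coprime_pairs n. 1 - q ^ (n div max r s)) / (real n)\<^sup>2)"
  proof
    fix n
    have "(\<Sum>k. a (Suc k - 1) n) = (\<Sum>j=1..n. a (j - 1) n)"
      by (rule suminf_Suc_eq_sum) (auto simp: a_def)
    also have "\<dots> = (\<Sum>j=1..n. (1 - q) * q ^ (j - 1) * real (card (coprime_pairs (n div j))) / (real n)\<^sup>2)"
      by (intro sum.cong) (auto simp: a_def)
    also have "\<dots> = (\<Sum>(r, s)\<in>coprime_pairs n. 1 - q ^ (n div max r s)) / (real n)\<^sup>2"
      by (subst sum_coprime_pairs_geometric) (simp add: sum_divide_distrib)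
    finally show "(\<Sum>k. a k n) = \<dots>" by simp
  qed
  finally show ?thesis .
qed

section \<open>Mean and variance of the number of ratios\<close>

lemma finite_set_Pi_bernoulli: "finite S \<Longrightarrow> finite (set_pmf (Pi_pmf S d (\<lambda>_. bernoulli_pmf \<alpha>)))"
  by (intro finite_set_Pi_pmf) (auto intro: finite_subset[of _ UNIV])

text \<open>The count is a sum of indicators over coprime pairs. \<open>prob_ratio_hit\<close> is
  exact when \<open>max r s\<close> exceeds sqrt n; for each of the at most \<open>n\<close> other
  pairs, two numbers in [0, 1] differ by at most 1.\<close>

lemma expectation_card_ratio_set:
  fixes n :: nat
  assumes "0 \<le> \<alpha>" "\<alpha> \<le> 1"
  shows "\<bar>measure_pmf.expectation (Pi_pmf {1..n} False (\<lambda>_. bernoulli_pmf \<alpha>))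
      (\<lambda>f. real (card (ratio_set ({m. f m} \<inter> {1..n}))))
    - (\<Sum>(r, s)\<in>coprime_pairs n. 1 - (1 - \<alpha>\<^sup>2) ^ (n div max r s))\<bar> \<le> real n"
proof -
  let ?P = "Pi_pmf {1..n} False (\<lambda>_. bernoulli_pmf \<alpha>)"
  define E where "E = (\<lambda>(r, s). {f. \<exists>k\<in>{1..n div max r s}. f (k * r) \<and> f (k * s)})"
  define p where "p = (\<lambda>(r, s). 1 - (1 - \<alpha>\<^sup>2) ^ (n div max r s))"
  let ?small = "{(r, s) \<in> coprime_pairs n. (max r s)\<^sup>2 \<le> n}"
  note [simp] = integrable_measure_pmf_finite[OF finite_set_Pi_bernoulli]
  have card_eq: "real (card (ratio_set ({m. f m} \<inter> {1..n}))) = (\<Sum>x\<in>coprime_pairs n. indicator (E x) f)" for f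
  proof -
    \<comment> \<open>The multiples in question stay inside \<open>{1..n}\<close>, so the
      intersection in the count does not alter the events \<open>E\<close>.\<close>
    have "k * r \<in> {1..n} \<and> k * s \<in> {1..n}"
      if "(r, s) \<in> coprime_pairs n" "k \<in> {1..n div max r s}" for r s k
    proof -
      have "0 < r" "0 < s" using that by (auto simp: coprime_pairs_def)
      moreover from this have "k * max r s \<le> n" using that by (simp add: less_eq_div_iff_mult_less_eq)
      ultimately show ?thesis using that by (simp add: nat_mult_max_right Suc_le_eq)
    qed
    hence "{(r, s) \<in> coprime_pairs n. \<exists>k\<in>{1..n div max r s}. k * r \<in> {m. f m} \<inter> {1..n} \<and> k * s \<in> {m. f m} \<inter> {1..n}}
        = {x\<in>coprime_pairs n. f \<in> E x}"
      unfolding E_def by blast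
    hence "real (card (ratio_set ({m. f m} \<inter> {1..n}))) = (\<Sum>x | x \<in> coprime_pairs n \<and> f \<in> E x. 1)"
      by (subst card_ratio_set[of _ n]) simp_all
    also have "\<dots> = (\<Sum>x\<in>coprime_pairs n. if f \<in> E x then 1 else 0)"
      by (rule sum.inter_filter) simp
    also have "\<dots> = (\<Sum>x\<in>coprime_pairs n. indicator (E x) f)"
      by (intro sum.cong) (auto simp: indicator_def)
    finally show ?thesis .
  qed
  have "measure_pmf.expectation ?P (\<lambda>f. real (card (ratio_set ({m. f m} \<inter> {1..n}))))
     = (\<Sum>x\<in>coprime_pairs n. measure_pmf.prob ?P (E x))"
    unfolding card_eq by (subst Bochner_Integration.integral_sum) auto
  hence "\<bar>measure_pmf.expectation ?P (\<lambda>f. real (card (ratio_set ({m. f m} \<inter> {1..n})))) - (\<Sum>x\<in>coprime_pairs n. p x)\<bar>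
     = \<bar>\<Sum>x\<in>coprime_pairs n. measure_pmf.prob ?P (E x) - p x\<bar>"
    by (simp add: sum_subtractf)
  also have "\<dots> \<le> (\<Sum>x\<in>coprime_pairs n. \<bar>measure_pmf.prob ?P (E x) - p x\<bar>)"
    by (rule sum_abs)
  also have "\<dots> \<le> (\<Sum>x\<in>coprime_pairs n. if x \<in> ?small then 1 else 0)"
  proof (intro sum_mono)
    fix x assume x: "x \<in> coprime_pairs n"
    have "0 \<le> 1 - \<alpha>\<^sup>2" "1 - \<alpha>\<^sup>2 \<le> 1" using assms by (auto simp: power_le_one)
    hence "0 \<le> p x" "p x \<le> 1" by (auto simp: p_def power_le_one split: prod.splits)
    hence "\<bar>measure_pmf.prob ?P (E x) - p x\<bar> \<le> 1"
      using measure_nonneg[of ?P "E x"] measure_pmf.prob_le_1[of ?P "E x"] by linarith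
    moreover have "measure_pmf.prob ?P (E x) = p x" if "x \<notin> ?small"
      using prob_ratio_hit[OF assms, of "fst x" "snd x" n] x that
      by (cases x) (auto simp: E_def p_def)
    ultimately show "\<bar>measure_pmf.prob ?P (E x) - p x\<bar> \<le> (if x \<in> ?small then 1 else 0)"
      by (cases "x \<in> ?small") (simp_all only: if_True if_False not_False_eq_True simp_thms diff_self abs_zero order_refl)
  qed
  also have "\<dots> = real (card (coprime_pairs n \<inter> ?small))"
    by (simp add: sum.If_cases)
  also have "coprime_pairs n \<inter> ?small = ?small" by auto
  also have "real (card ?small) \<le> real n" using card_coprime_pairs_sqrt_le by simp
  finally show ?thesis by (simp add: p_def)
qed

text \<open>There are \<open>n\<close> coordinates, each of oscillation at most
  \<open>2 * n\<close>.\<close>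

lemma variance_card_ratio_set_le:
  fixes n :: nat
  shows "measure_pmf.variance (Pi_pmf {1..n} False (\<lambda>_. bernoulli_pmf \<alpha>))
      (\<lambda>f. real (card (ratio_set ({m. f m} \<inter> {1..n})))) \<le> 4 * real n ^ 3"
proof -
  have "measure_pmf.variance (Pi_pmf {1..n} False (\<lambda>_. bernoulli_pmf \<alpha>))
      (\<lambda>f. real (card (ratio_set ({m. f m} \<inter> {1..n})))) \<le> real (card {1..n}) * (2 * real n)\<^sup>2"
    by (intro variance_Pi_pmf_le card_ratio_set_flip) (auto intro: finite_subset[of _ UNIV])
  thus ?thesis by (simp add: power2_eq_square power3_eq_cube mult_ac)
qed

section \<open>Concentration by Chebyshev's inequality\<close>

text \<open>Predicates drawn from \<open>Pi_pmf\<close> take the default \<open>False\<close>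
  outside \<open>{1..n}\<close>, so the intersection that gives the moment bounds changes nothing
  almost surely.\<close>

lemma prob_random_subset_eq:
  "measure_pmf.prob (random_subset n \<alpha>) {A. Q A} =
   measure_pmf.prob (Pi_pmf {1..n} False (\<lambda>_. bernoulli_pmf \<alpha>)) {f. Q ({m. f m} \<inter> {1..n})}"
proof -
  have "{m. f m} \<inter> {1..n} = {m. f m}" if "f \<in> set_pmf (Pi_pmf {1..n} False (\<lambda>_. bernoulli_pmf \<alpha>))" for f
  proof -
    have "\<forall>m. m \<notin> {1..n} \<longrightarrow> f m = False"
      using subsetD[OF set_Pi_pmf_subset[OF finite_atLeastAtMost] that] by blast
    thus ?thesis by auto
  qed
  thus ?thesis
    unfolding random_subset_def measure_map_pmf
    by (intro measure_pmf.finite_measure_eq_AE) (auto simp: AE_measure_pmf_iff)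
qed

theorem theorem1p1:
  fixes \<alpha> :: real
  assumes "0 < \<alpha>" and "\<alpha> < 1"
  shows "\<forall>\<epsilon>::real. \<epsilon> > 0 \<longrightarrow>
    (\<lambda>n::nat. measure_pmf.prob (random_subset n \<alpha>)
       {A. \<bar>real (card (ratio_set A)) / (mu2 \<alpha> * (real n)\<^sup>2) - 1\<bar> > \<epsilon>}) \<longlonglongrightarrow> 0"
proof (intro allI impI)
  fix \<epsilon> :: real assume "\<epsilon> > 0"
  define P where "P = (\<lambda>n::nat. Pi_pmf {1..n} False (\<lambda>_. bernoulli_pmf \<alpha>))"
  define X where "X = (\<lambda>n f. real (card (ratio_set ({m. f m} \<inter> {1..n}))))"
  define \<mu> where "\<mu> = mu2 \<alpha>"
  define S where "S = (\<lambda>n. \<Sum>(r, s)\<in>coprime_pairs n. 1 - (1 - \<alpha>\<^sup>2) ^ (n div max r s))"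
  define EE where "EE = (\<lambda>n. measure_pmf.expectation (P n) (X n))"
  have \<mu>: "\<mu> > 0" unfolding \<mu>_def using assms by (rule mu2_pos)
  \<comment> \<open>Half of the allowed deviation \<epsilon> * \<mu> absorbs the distance from the
    normalised mean to \<mu>; the other half is left for the fluctuation about the mean.\<close>
  define \<delta> where "\<delta> = \<epsilon> * \<mu> / 2"
  have \<delta>: "\<delta> > 0" using \<mu> \<open>\<epsilon> > 0\<close> by (simp add: \<delta>_def)
  have "(\<lambda>n. EE n / (real n)\<^sup>2 - S n / (real n)\<^sup>2) \<longlonglongrightarrow> 0"
  proof (rule Lim_null_comparison)
    have "norm (EE n / (real n)\<^sup>2 - S n / (real n)\<^sup>2) \<le> real n / (real n)\<^sup>2" for n
      using expectation_card_ratio_set[of \<alpha> n] assms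
      by (simp add: EE_def P_def X_def S_def divide_right_mono flip: diff_divide_distrib)
    thus "eventually (\<lambda>n. norm (EE n / (real n)\<^sup>2 - S n / (real n)\<^sup>2) \<le> real n / (real n)\<^sup>2) sequentially"
      by simp
    show "(\<lambda>n. real n / (real n)\<^sup>2) \<longlonglongrightarrow> 0" by real_asymp
  qed
  from tendsto_add[OF this mean_main_term_tendsto[OF assms]]
  have "(\<lambda>n. EE n / (real n)\<^sup>2) \<longlonglongrightarrow> \<mu>" by (simp add: S_def \<mu>_def)
  hence EE: "eventually (\<lambda>n. dist (EE n / (real n)\<^sup>2) \<mu> < \<delta>) sequentially"
    using \<delta> by (rule tendstoD)
  show "(\<lambda>n::nat. measure_pmf.prob (random_subset n \<alpha>)
       {A. \<bar>real (card (ratio_set A)) / (mu2 \<alpha> * (real n)\<^sup>2) - 1\<bar> > \<epsilon>}) \<longlonglongrightarrow> 0"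
  proof (rule Lim_null_comparison)
    \<comment> \<open>The bound is variance over squared deviation and equals 4 / (\<delta>^2 n) for
      positive \<open>n\<close>.\<close>
    show "eventually (\<lambda>n. norm (measure_pmf.prob (random_subset n \<alpha>)
       {A. \<bar>real (card (ratio_set A)) / (mu2 \<alpha> * (real n)\<^sup>2) - 1\<bar> > \<epsilon>}) \<le>
        4 * real n ^ 3 / (\<delta> * (real n)\<^sup>2)\<^sup>2) sequentially"
      using EE eventually_gt_at_top[of 0]
    proof eventually_elim
      case (elim n)
      hence n: "(real n)\<^sup>2 > 0" by simp
      have "{f. \<bar>X n f / (\<mu> * (real n)\<^sup>2) - 1\<bar> > \<epsilon>} \<subseteq> {f \<in> space (P n). \<delta> * (real n)\<^sup>2 \<le> \<bar>X n f - EE n\<bar>}"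
      proof clarsimp
        fix f assume "\<epsilon> < \<bar>X n f / (\<mu> * (real n)\<^sup>2) - 1\<bar>"
        hence "\<epsilon> * \<mu> < \<bar>X n f / (\<mu> * (real n)\<^sup>2) - 1\<bar> * \<mu>" using \<mu> by simp
        also have "\<dots> = \<bar>(X n f / (\<mu> * (real n)\<^sup>2) - 1) * \<mu>\<bar>" using \<mu> by (simp add: abs_mult)
        also have "(X n f / (\<mu> * (real n)\<^sup>2) - 1) * \<mu> = X n f / (real n)\<^sup>2 - \<mu>"
          using \<mu> by (simp add: algebra_simps)
        finally have "\<delta> \<le> \<bar>X n f / (real n)\<^sup>2 - EE n / (real n)\<^sup>2\<bar>"
          using elim(1) unfolding dist_real_def \<delta>_def by linarith
        also have "\<dots> = \<bar>X n f - EE n\<bar> / (real n)\<^sup>2"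
          by (simp flip: diff_divide_distrib)
        finally show "\<delta> * (real n)\<^sup>2 \<le> \<bar>X n f - EE n\<bar>" using n by (simp add: field_simps)
      qed
      hence "measure_pmf.prob (P n) {f. \<bar>X n f / (\<mu> * (real n)\<^sup>2) - 1\<bar> > \<epsilon>} \<le>
          measure_pmf.prob (P n) {f \<in> space (P n). \<delta> * (real n)\<^sup>2 \<le> \<bar>X n f - EE n\<bar>}"
        by (intro measure_pmf.finite_measure_mono) auto
      also have "\<dots> \<le> measure_pmf.variance (P n) (X n) / (\<delta> * (real n)\<^sup>2)\<^sup>2"
        unfolding EE_def
        by (intro measure_pmf.Chebyshev_inequality integrable_measure_pmf_finite)
           (use \<delta> n in \<open>auto simp: P_def intro: finite_set_Pi_bernoulli\<close>)
      also have "\<dots> \<le> 4 * real n ^ 3 / (\<delta> * (real n)\<^sup>2)\<^sup>2"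
        unfolding X_def P_def by (intro divide_right_mono variance_card_ratio_set_le) auto
      finally show ?case
        unfolding prob_random_subset_eq by (simp add: X_def P_def \<mu>_def)
    qed
    show "(\<lambda>n. 4 * real n ^ 3 / (\<delta> * (real n)\<^sup>2)\<^sup>2) \<longlonglongrightarrow> 0"
      using \<delta> by real_asymp
  qed
qed

end
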